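(* Let $G$ be a simple graph, let $e=v_iv_j$ be an edge of $G$, and let $v$ be the vertex of the line graph $L(G)$ corresponding to $e$. Then $$d^p_{L(G)}(v)=\Lambda+\binom{d(v_i)-1}{2}+\binom{d(v_j)-1}{2},$$ where $\Lambda$ is the number of triangles of $G$ containing the edge $e$ and $d(\cdot)$ denotes degree in $G$.
   Context: The line graph $L(G)$ has the edges of $G$ as vertices, two of them adjacent if and only if they share an endpoint in $G$. The primitive degree $d^p_H(v)$ of a vertex $v$ of a graph $H$ is the number of triangles ($C_3$ subgraphs) of $H$ containing $v$. *)

theory Defs
  imports Main
begin

record 'a ugraph =
  verts :: "'a set"
  edges :: "'a set set"

definition simple_graph :: "'a ugraph \<Rightarrow> bool" where
  "simple_graph G \<longleftrightarrow>
     finite (verts G) \<and> (\<forall>e\<in>edges G. e \<subseteq> verts G \<and> card e = 2)"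

definition degree :: "'a ugraph \<Rightarrow> 'a \<Rightarrow> nat" where
  "degree G v = card {e \<in> edges G. v \<in> e}"

definition subgraph :: "'a ugraph \<Rightarrow> 'a ugraph \<Rightarrow> bool" where
  "subgraph H G \<longleftrightarrow> simple_graph H \<and> verts H \<subseteq> verts G \<and> edges H \<subseteq> edges G"

definition is_C3 :: "'a ugraph \<Rightarrow> bool" where
  "is_C3 T \<longleftrightarrow> (\<exists>x y z. x \<noteq> y \<and> y \<noteq> z \<and> x \<noteq> z \<and>
     T = \<lparr>verts = {x, y, z}, edges = {{x, y}, {y, z}, {x, z}}\<rparr>)"

definition triangles :: "'a ugraph \<Rightarrow> 'a ugraph set" where
  "triangles G = {T. subgraph T G \<and> is_C3 T}"

definition primitive_degree :: "'a ugraph \<Rightarrow> 'a \<Rightarrow> nat" where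
  "primitive_degree H v = card {T \<in> triangles H. v \<in> verts T}"

definition line_graph :: "'a ugraph \<Rightarrow> 'a set ugraph" where
  "line_graph G =
     \<lparr>verts = edges G,
      edges = {{e, f} | e f. e \<in> edges G \<and> f \<in> edges G \<and> e \<noteq> f \<and> e \<inter> f \<noteq> {}}\<rparr>"

lemma finite_edges: "simple_graph G \<Longrightarrow> finite (edges G)"
  unfolding simple_graph_def by (meson PowI finite_Pow_iff finite_subset subsetI)

lemma simple_graph_line_graph: "simple_graph G \<Longrightarrow> simple_graph (line_graph G)"
  using finite_edges[of G]
  unfolding simple_graph_def[of "line_graph G"] by (auto simp: line_graph_def card_2_iff)

end

theory Submission
  imports Defs
begin

text \<open>
  A triangle of L(G) through e = v_i v_j is determined by the pair of its other two vertices, which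
  are edges f, g of G meeting e and each other. Either f and g both contain v_i, or both contain
  v_j, and any such pair works; or one is v_i w and the other v_j w for a common neighbour w of
  v_i and v_j, that is, e, f, g are the edges of a triangle of G.
\<close>

text \<open>The record inside \<open>is_C3\<close> as a function of its vertices. Distinctness is
  left out, since in a simple graph it follows from the sides being edges.\<close>

definition C3 :: "'a \<Rightarrow> 'a \<Rightarrow> 'a \<Rightarrow> 'a ugraph" where
  "C3 x y z = \<lparr>verts = {x, y, z}, edges = {{x, y}, {y, z}, {x, z}}\<rparr>"

lemma verts_C3 [simp]: "verts (C3 x y z) = {x, y, z}"
  and edges_C3 [simp]: "edges (C3 x y z) = {{x, y}, {y, z}, {x, z}}"
  by (simp_all add: C3_def)

lemma C3_swap12: "C3 x y z = C3 y x z"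
  and C3_swap23: "C3 x y z = C3 x z y"
  by (simp_all add: C3_def insert_commute)

text \<open>A triangle is the complete graph on its vertex set, so this set determines it.
  Distinctness leaves only permutations of v, a, b, all giving the same record.\<close>

lemma C3_eqI_verts:
  assumes "{x, y, z} = {v, a, b}" "x \<noteq> y" "y \<noteq> z" "x \<noteq> z"
  shows "C3 x y z = C3 v a b"
proof -
  have "(x = v \<or> x = a \<or> x = b) \<and> (y = v \<or> y = a \<or> y = b) \<and> (z = v \<or> z = a \<or> z = b)"
    using assms(1) by blast
  then show ?thesis
    using assms(2-) by (elim conjE disjE) (simp_all add: C3_def insert_commute)
qed

lemma edge_distinct: "simple_graph G \<Longrightarrow> {x, y} \<in> edges G \<Longrightarrow> x \<noteq> y"
  by (force simp: simple_graph_def)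

lemma edge_in_verts: "simple_graph G \<Longrightarrow> {x, y} \<in> edges G \<Longrightarrow> x \<in> verts G \<and> y \<in> verts G"
  by (force simp: simple_graph_def)

lemma edge_other_endE:
  assumes "simple_graph G" "f \<in> edges G" "x \<in> f"
  obtains w where "f = {x, w}" "w \<noteq> x"
  using assms unfolding simple_graph_def card_2_iff by (metis doubleton_eq_iff insertE singletonD)

lemma C3_in_triangles:
  assumes "simple_graph G" "{x, y} \<in> edges G" "{y, z} \<in> edges G" "{x, z} \<in> edges G"
  shows "C3 x y z \<in> triangles G"
proof -
  have "x \<noteq> y" "y \<noteq> z" "x \<noteq> z"
    using assms edge_distinct by metis+
  then show ?thesis
    using assms edge_in_verts[OF assms(1)]
    by (auto simp: triangles_def subgraph_def simple_graph_def[of "C3 x y z"] is_C3_def C3_def[symmetric])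
qed

lemma trianglesE:
  assumes "T \<in> triangles G"
  obtains x y z where "T = C3 x y z" "x \<noteq> y" "y \<noteq> z" "x \<noteq> z"
    "{x, y} \<in> edges G" "{y, z} \<in> edges G" "{x, z} \<in> edges G"
  using assms by (auto simp: triangles_def subgraph_def is_C3_def C3_def)

text \<open>By the symmetry of \<open>C3\<close> any chosen vertex of a triangle may be listed
  first.\<close>

lemma trianglesE_vertex:
  assumes "T \<in> triangles G" "v \<in> verts T"
  obtains a b where "T = C3 v a b" "v \<noteq> a" "a \<noteq> b" "v \<noteq> b"
    "{v, a} \<in> edges G" "{a, b} \<in> edges G" "{v, b} \<in> edges G"
proof -
  obtain x y z where *: "T = C3 x y z" "x \<noteq> y" "y \<noteq> z" "x \<noteq> z"
    "{x, y} \<in> edges G" "{y, z} \<in> edges G" "{x, z} \<in> edges G"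
    using assms(1) by (rule trianglesE)
  then consider "v = x" | "v = y" | "v = z"
    using assms(2) by auto
  then show ?thesis
  proof cases
    case 1
    then show ?thesis using * that by blast
  next
    case 2
    then show ?thesis using * that[of x z] C3_swap12[of x y z] by (simp add: insert_commute)
  next
    case 3
    then show ?thesis
      using * that[of x y] C3_swap12[of x z y] C3_swap23[of x y z] by (simp add: insert_commute)
  qed
qed

text \<open>For simple H these are the sides opposite v in the triangles through v, i.e. the edges
  of the graph induced on the neighbourhood of v.\<close>

definition link_edges :: "'a ugraph \<Rightarrow> 'a \<Rightarrow> 'a set set" where
  "link_edges H v = {{a, b} | a b. {v, a} \<in> edges H \<and> {v, b} \<in> edges H \<and> {a, b} \<in> edges H}"

text \<open>Deleting v from the vertex set sends a triangle through v to its opposite side. This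
  replaces counting subgraphs by counting two-element sets.\<close>

lemma primitive_degree_eq_card_link_edges:
  assumes "simple_graph H"
  shows "primitive_degree H v = card (link_edges H v)"
proof -
  let ?T = "{T \<in> triangles H. v \<in> verts T}"
  have "inj_on (\<lambda>T. verts T - {v}) ?T"
  proof (rule inj_onI)
    fix S T assume *: "S \<in> ?T" "T \<in> ?T" "verts S - {v} = verts T - {v}"
    \<comment> \<open>Both vertex sets contain v, so nothing is lost by deleting it.\<close>
    then have "verts S = verts T" by auto
    moreover obtain x y z where "S = C3 x y z" "x \<noteq> y" "y \<noteq> z" "x \<noteq> z"
      using *(1) by (auto elim: trianglesE)
    moreover obtain a b c where "T = C3 a b c"
      using *(2) by (auto elim: trianglesE)
    ultimately show "S = T"
      using C3_eqI_verts[of x y z a b c] by simp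
  qed
  moreover have "(\<lambda>T. verts T - {v}) ` ?T = link_edges H v"
  proof (intro equalityI subsetI)
    fix S assume "S \<in> (\<lambda>T. verts T - {v}) ` ?T"
    then obtain T where "T \<in> triangles H" "v \<in> verts T" and S: "S = verts T - {v}" by auto
    then obtain a b where "T = C3 v a b" "v \<noteq> a" "a \<noteq> b" "v \<noteq> b"
      "{v, a} \<in> edges H" "{a, b} \<in> edges H" "{v, b} \<in> edges H"
      by (elim trianglesE_vertex)
    moreover from this have "S = {a, b}" using S by auto
    ultimately show "S \<in> link_edges H v" unfolding link_edges_def by blast
  next
    fix S assume "S \<in> link_edges H v"
    then obtain a b where S: "S = {a, b}" and
      e: "{v, a} \<in> edges H" "{a, b} \<in> edges H" "{v, b} \<in> edges H"
      unfolding link_edges_def by blast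
    have "C3 v a b \<in> ?T" using C3_in_triangles[OF assms e] by simp
    moreover have "S = verts (C3 v a b) - {v}"
      using e[THEN edge_distinct[OF assms]] S by auto
    ultimately show "S \<in> (\<lambda>T. verts T - {v}) ` ?T" by blast
  qed
  ultimately show ?thesis
    unfolding primitive_degree_def by (metis card_image)
qed

definition common_neighbours :: "'a ugraph \<Rightarrow> 'a \<Rightarrow> 'a \<Rightarrow> 'a set" where
  "common_neighbours G u v = {w. {u, w} \<in> edges G \<and> {v, w} \<in> edges G}"

lemma finite_common_neighbours: "simple_graph G \<Longrightarrow> finite (common_neighbours G u v)"
  by (rule finite_subset[of _ "verts G"])
     (auto simp: common_neighbours_def simple_graph_def)

text \<open>A triangle on a fixed edge is determined by its third vertex, which can be any common
  neighbour of the two ends.\<close>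

lemma card_triangles_edge:
  assumes "simple_graph G" "{u, v} \<in> edges G"
  shows "card {T \<in> triangles G. {u, v} \<in> edges T} = card (common_neighbours G u v)"
proof -
  have "inj_on (C3 u v) (common_neighbours G u v)"
  proof (rule inj_onI)
    fix w x assume *: "w \<in> common_neighbours G u v" "x \<in> common_neighbours G u v" "C3 u v w = C3 u v x"
    then have "{u, v, w} = {u, v, x}" by (metis verts_C3)
    moreover have "w \<noteq> u" "w \<noteq> v"
      using * edge_distinct[OF assms(1)] by (auto simp: common_neighbours_def)
    ultimately show "w = x" by auto
  qed
  moreover have "C3 u v ` common_neighbours G u v = {T \<in> triangles G. {u, v} \<in> edges T}"
  proof (intro equalityI subsetI)
    fix T assume "T \<in> C3 u v ` common_neighbours G u v"
    then show "T \<in> {T \<in> triangles G. {u, v} \<in> edges T}"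
      using C3_in_triangles[OF assms] by (auto simp: common_neighbours_def)
  next
    fix T assume "T \<in> {T \<in> triangles G. {u, v} \<in> edges T}"
    then have T: "T \<in> triangles G" "{u, v} \<in> edges T" by auto
    then have "u \<in> verts T" by (auto elim!: trianglesE)
    with T(1) obtain a b where *: "T = C3 u a b" "u \<noteq> a" "a \<noteq> b" "u \<noteq> b"
      "{u, a} \<in> edges G" "{a, b} \<in> edges G" "{u, b} \<in> edges G"
      by (elim trianglesE_vertex)
    \<comment> \<open>The vertex u differs from a and b, so {u, v} cannot be the side {a,
      b}.\<close>
    have "v = a \<or> v = b" using T(2) * by (auto simp: doubleton_eq_iff)
    then have "T = C3 u v a \<and> a \<in> common_neighbours G u v \<or> T = C3 u v b \<and> b \<in> common_neighbours G u v"
      using * C3_swap23[of u a b] by (auto simp: common_neighbours_def insert_commute)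
    then show "T \<in> C3 u v ` common_neighbours G u v" by blast
  qed
  ultimately show ?thesis by (metis card_image)
qed

text \<open>When x is an end of the edge e, these are the neighbours of e in the line graph that
  meet e at x.\<close>

definition other_edges :: "'a ugraph \<Rightarrow> 'a set \<Rightarrow> 'a \<Rightarrow> 'a set set" where
  "other_edges G e x = {f \<in> edges G. x \<in> f} - {e}"

lemma card_other_edges:
  assumes "e \<in> edges G" "x \<in> e"
  shows "card (other_edges G e x) = degree G x - 1"
  unfolding other_edges_def degree_def using assms by (simp add: card_Diff_singleton)

lemma finite_other_edges: "simple_graph G \<Longrightarrow> finite (other_edges G e x)"
  by (simp add: other_edges_def finite_edges)

lemma edge_line_graph_iff:
  "{f, g} \<in> edges (line_graph G) \<longleftrightarrow> f \<in> edges G \<and> g \<in> edges G \<and> f \<noteq> g \<and> f \<inter> g \<noteq> {}"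
  by (auto simp: line_graph_def doubleton_eq_iff)

text \<open>An edge has only two elements, so one containing both u and v is {u, v}, which has been
  removed.\<close>

lemma other_edges_disjoint:
  assumes "simple_graph G" "u \<noteq> v"
  shows "other_edges G {u, v} u \<inter> other_edges G {u, v} v = {}"
  using assms by (auto simp: other_edges_def elim!: edge_other_endE)

text \<open>Pairs of neighbours of {u, v} are sorted by the ends at which they meet it: different
  ends give the first set, a common end gives the other two. The latter are written as two-element
  subsets so that \<open>n_subsets\<close> can count them.\<close>

lemma link_edges_line_graph:
  assumes "simple_graph G" "{u, v} \<in> edges G"
  shows "link_edges (line_graph G) {u, v} =
    (\<lambda>w. {{u, w}, {v, w}}) ` common_neighbours G u v
    \<union> {S. S \<subseteq> other_edges G {u, v} u \<and> card S = 2}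
    \<union> {S. S \<subseteq> other_edges G {u, v} v \<and> card S = 2}" (is "_ = ?W \<union> ?U \<union> ?V")
proof (intro equalityI subsetI)
  have mixed: "{f, g} \<in> ?W"
    if f: "f \<in> other_edges G {u, v} u" and g: "g \<in> other_edges G {u, v} v" and "f \<inter> g \<noteq> {}" for f g
  proof -
    obtain w where w: "f = {u, w}" "w \<noteq> u"
      using f assms(1) edge_other_endE[of G f u] by (auto simp: other_edges_def)
    obtain x where x: "g = {v, x}" "x \<noteq> v"
      using g assms(1) edge_other_endE[of G g v] by (auto simp: other_edges_def)
    \<comment> \<open>Neither f nor g is {u, v}, so w is not v and x is not u; as u and v differ
      too, a shared vertex can only be w = x.\<close>
    have "w = x"
      using f g w x edge_distinct[OF assms] that(3) by (auto simp: other_edges_def insert_commute)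
    then show ?thesis
      using f g w x by (auto simp: other_edges_def common_neighbours_def)
  qed
  fix S assume "S \<in> link_edges (line_graph G) {u, v}"
  then obtain f g where S: "S = {f, g}" and fg: "f \<in> edges G" "g \<in> edges G" "f \<noteq> g" "f \<inter> g \<noteq> {}"
    and "f \<noteq> {u, v}" "g \<noteq> {u, v}" "{u, v} \<inter> f \<noteq> {}" "{u, v} \<inter> g \<noteq> {}"
    unfolding link_edges_def edge_line_graph_iff by blast
  then have "f \<in> other_edges G {u, v} u \<or> f \<in> other_edges G {u, v} v"
    "g \<in> other_edges G {u, v} u \<or> g \<in> other_edges G {u, v} v"
    by (auto simp: other_edges_def)
  moreover have "card S = 2" using S fg by simp
  \<comment> \<open>Since S is unordered, either of f and g may be the one through u; hence both
    instances of \<open>mixed\<close>.\<close>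
  ultimately show "S \<in> ?W \<union> ?U \<union> ?V"
    using mixed[of f g] mixed[of g f] S fg(4) by (auto simp: insert_commute Int_commute)
next
  \<comment> \<open>Edges through one end x all share x, so no further condition is needed for
    adjacency.\<close>
  have star: "S \<in> link_edges (line_graph G) {u, v}"
    if "S \<subseteq> other_edges G {u, v} x" "card S = 2" "x \<in> {u, v}" for S x
  proof -
    obtain f g where S: "S = {f, g}" "f \<noteq> g" using \<open>card S = 2\<close> by (auto simp: card_2_iff)
    then have "{{u, v}, f} \<in> edges (line_graph G)" "{{u, v}, g} \<in> edges (line_graph G)"
      "{f, g} \<in> edges (line_graph G)"
      using that assms(2) unfolding edge_line_graph_iff by (auto simp: other_edges_def)
    then show ?thesis unfolding link_edges_def S by blast
  qed
  fix S assume "S \<in> ?W \<union> ?U \<union> ?V"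
  then consider w where "w \<in> common_neighbours G u v" "S = {{u, w}, {v, w}}" | "S \<in> ?U" | "S \<in> ?V"
    by blast
  then show "S \<in> link_edges (line_graph G) {u, v}"
  proof cases
    case 1
    then have "w \<noteq> u" "w \<noteq> v"
      using edge_distinct[OF assms(1)] by (auto simp: common_neighbours_def)
    then have "{{u, v}, {u, w}} \<in> edges (line_graph G)" "{{u, v}, {v, w}} \<in> edges (line_graph G)"
      "{{u, w}, {v, w}} \<in> edges (line_graph G)"
      using 1 edge_distinct[OF assms] assms(2) unfolding edge_line_graph_iff
      by (auto simp: common_neighbours_def doubleton_eq_iff)
    then show ?thesis unfolding link_edges_def 1(2) by blast
  qed (use star in auto)
qed

theorem theorem4p3:
  fixes G :: "'a ugraph" and vi vj :: 'a
  assumes "simple_graph G"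
    and "{vi, vj} \<in> edges G"
  shows "primitive_degree (line_graph G) {vi, vj} =
           card {T \<in> triangles G. {vi, vj} \<in> edges T}
           + ((degree G vi - 1) choose 2) + ((degree G vj - 1) choose 2)"
proof -
  let ?A = "\<lambda>x. other_edges G {vi, vj} x"
  let ?P = "\<lambda>x. {S. S \<subseteq> ?A x \<and> card S = 2}"
  let ?N = "common_neighbours G vi vj"
  let ?W = "(\<lambda>w. {{vi, w}, {vj, w}}) ` ?N"
  have ne: "vi \<noteq> vj" using edge_distinct[OF assms] .
  have nb: "w \<noteq> vi" "w \<noteq> vj" if "w \<in> ?N" for w
    using that edge_distinct[OF assms(1)] by (auto simp: common_neighbours_def)
  have fin: "finite (?P x)" for x
    using finite_other_edges[OF assms(1)] by simp
  have finW: "finite ?W" using finite_common_neighbours[OF assms(1)] by simp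
  \<comment> \<open>If two such pairs agree and {vi, w} equals {vj, x}, then w = vj, which
    \<open>nb\<close> excludes. So {vi, w} = {vi, x} and w = x.\<close>
  have "inj_on (\<lambda>w. {{vi, w}, {vj, w}}) ?N"
    using nb ne by (auto intro!: inj_onI simp: doubleton_eq_iff)
  then have W: "card ?W = card ?N" by (rule card_image)
  have P: "card (?P x) = (degree G x - 1) choose 2" if "x \<in> {vi, vj}" for x
    using n_subsets[OF finite_other_edges[OF assms(1)]] card_other_edges[OF assms(2) that] by metis
  \<comment> \<open>Disjoint sets still share the empty subset; size 2 rules it out.\<close>
  have "S \<notin> ?P vj" if "S \<in> ?P vi" for S
    using that other_edges_disjoint[OF assms(1) ne] by (auto simp: card_2_iff)
  then have disj_P: "?P vi \<inter> ?P vj = {}" by blast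
  \<comment> \<open>The edge {vj, w} misses vi and {vi, w} misses vj, so the pair has no common end
    on the given edge.\<close>
  have "{{vi, w}, {vj, w}} \<notin> ?P vi \<union> ?P vj" if "w \<in> ?N" for w
    using nb[OF that] ne by (auto simp: other_edges_def)
  then have disj_W: "?W \<inter> (?P vi \<union> ?P vj) = {}" by blast
  have "primitive_degree (line_graph G) {vi, vj} = card (?W \<union> (?P vi \<union> ?P vj))"
    by (simp only: primitive_degree_eq_card_link_edges[OF simple_graph_line_graph[OF assms(1)]]
        link_edges_line_graph[OF assms] Un_assoc)
  also have "\<dots> = card ?W + (card (?P vi) + card (?P vj))"
    using card_Un_disjoint[OF finW _ disj_W] card_Un_disjoint[OF fin fin disj_P] fin by simp
  also have "\<dots> = card {T \<in> triangles G. {vi, vj} \<in> edges T}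
           + ((degree G vi - 1) choose 2) + ((degree G vj - 1) choose 2)"
    using W P[of vi] P[of vj] card_triangles_edge[OF assms] by simp
  finally show ?thesis .
qed

end
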